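(* Let $G(s;\alpha)=C(\alpha)(sI-A(\alpha))^{-1}B(\alpha)+D(\alpha)$ with $A(\alpha)\in\mathbb{R}[\alpha]^{n\times n}$, $B(\alpha)\in\mathbb{R}[\alpha]^{n\times m}$, $C(\alpha)\in\mathbb{R}[\alpha]^{o\times n}$, $D(\alpha)\in\mathbb{R}[\alpha]^{o\times m}$ be a parameter-dependent continuous-time linear system with parameter vector $\alpha\in\mathbb{R}^p$. Assume that the compact set $\mathcal{A}\subset\mathbb{R}^p$ of eligible parameters can be characterized as $$\mathcal{A}=\left\{\alpha\in\mathbb{R}^{p} \;|\; q_\ell(\alpha)\geq 0,\ \forall\, 1\leq \ell \leq L \right\},$$ where $q_\ell\in\mathbb{R}[\alpha]$ for all $1\leq \ell\leq L$. Furthermore, assume that there exist $w_\ell\in\mathcal{S}[\alpha]$ for all $0\leq \ell\leq L$ such that $\{\alpha\in\mathbb{R}^{p}\;|\; w_0(\alpha)+\sum_{\ell=1}^L q_\ell(\alpha)w_\ell(\alpha)\geq 0\}$ is a compact set. Let $\gamma\in\mathbb{R}_{\geq 0}$, and fix a reduced system $G'(s;\alpha')=C'(\alpha')(sI-A'(\alpha'))^{-1}B'(\alpha')+D'(\alpha')$ with $A'(\alpha')\in\mathbb{R}[\alpha']^{n'\times n'}$, $B'(\alpha')\in\mathbb{R}[\alpha']^{n'\times m}$, $C'(\alpha')\in\mathbb{R}[\alpha']^{o\times n'}$, $D'(\alpha')\in\mathbb{R}[\alpha']^{o\times m}$, where $\alpha'=T(\alpha)=[\alpha_1\ \cdots\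 \alpha_{p'}]^\top$ and $p'\leq p$. Define $$\tilde{A}(\alpha)=\begin{bmatrix}A(\alpha) & 0\\ 0 & A'(\alpha')\end{bmatrix},\quad \tilde{B}(\alpha)=\begin{bmatrix}B(\alpha)\\ B'(\alpha')\end{bmatrix},\quad \tilde{C}(\alpha)=\begin{bmatrix}C(\alpha) & -C'(\alpha')\end{bmatrix},\quad \tilde{D}(\alpha)=D(\alpha)-D'(\alpha').$$ If there exist a constant $\epsilon\in\mathbb{R}_{>0}$ and polynomial matrices $P(\alpha)\in\mathcal{S}[\alpha]^{n+n'}$ and $Q_\ell(\alpha)\in\mathcal{S}[\alpha]^{n+n'+m+o}$ for all $0\leq \ell\leq L$ such that the polynomial matrix identity $$\begin{bmatrix}\tilde{A}(\alpha)^\top P(\alpha)+P(\alpha)\tilde{A}(\alpha) & P(\alpha)\tilde{B}(\alpha) & \tilde{C}(\alpha)^\top\\ \tilde{B}(\alpha)^\top P(\alpha) & -I & \tilde{D}(\alpha)^\top\\ \tilde{C}(\alpha) & \tilde{D}(\alpha) & -\gamma^2 I\end{bmatrix}+\epsilon I+Q_0(\alpha)+\sum_{\ell=1}^L Q_\ell(\alpha)q_\ell(\alpha)=0$$ holds, then $\|G(s;\alpha)-G'(s;T(\alpha))\|_\infty\leq\gamma$ for all $\alpha\in\mathcal{A}$.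
   Context: $\mathbb{R}[\alpha]$ is the ring of real polynomials in the entries of $\alpha=(\alpha_1,\dots,\alpha_p)$, and $\mathbb{R}[\alpha]^{k\times l}$ is the set of $k\times l$ matrices with entries in $\mathbb{R}[\alpha]$. $\mathcal{S}[\alpha]^k$ is the set of sum-of-squares matrices, i.e. those $X(\alpha)\in\mathbb{R}[\alpha]^{k\times k}$ for which there exists $Y(\alpha)\in\mathbb{R}[\alpha]^{k\times k}$ with $X(\alpha)=Y(\alpha)^\top Y(\alpha)$; $\mathcal{S}[\alpha]=\mathcal{S}[\alpha]^1$. The dimensions $n,n',m,o,p,p'$ are natural numbers ($n,n'$: state dimensions; $m$: inputs; $o$: outputs). For each fixed $\alpha$, $G(s;\alpha)-G'(s;T(\alpha))$ is the transfer function $\tilde C(\alpha)(sI-\tilde A(\alpha))^{-1}\tilde B(\alpha)+\tilde D(\alpha)$ of a continuous-time linear time-invariant system, and $\|\cdot\|_\infty$ is the usual continuous-time $H_\infty$-norm (the supremum over $\mathrm{Re}\, s>0$ of the largest singular value of the transfer matrix). *)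

theory Defs
  imports
    "HOL-Analysis.Abstract_Euclidean_Space"
    "HOL-Library.Poly_Mapping"
    "HOL-Library.Extended_Nonnegative_Real"
    "Jordan_Normal_Form.Gauss_Jordan_Elimination"
    "Jordan_Normal_Form.Char_Poly"
    "Jordan_Normal_Form.Schur_Decomposition"
begin

section \<open>Real polynomials in finitely many variables\<close>

text \<open>
  A polynomial is a finitely supported map from monomials to coefficients, and a monomial is a
  finitely supported map from variable indices to exponents. The ring structure (convolution
  product) is the library's instance for \<^typ>\<open>'a \<Rightarrow>\<^sub>0 'b\<close>.  The parameters
  \<open>\<alpha>\<^sub>1, \<dots>, \<alpha>\<^sub>p\<close> are the variables with indices \<open>0, \<dots>, p - 1\<close>. Points of \<open>\<real>\<^sup>p\<close>
  are the elements of \<open>topspace (Euclidean_space p)\<close>, that is, sequences vanishing from index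
  \<open>p\<close> on.
\<close>

type_synonym mpoly = "(nat \<Rightarrow>\<^sub>0 nat) \<Rightarrow>\<^sub>0 real"

definition polys :: "nat \<Rightarrow> mpoly set" where
  "polys p = {f. \<forall>m \<in> Poly_Mapping.keys f. Poly_Mapping.keys m \<subseteq> {..<p}}"

definition const_poly :: "real \<Rightarrow> mpoly" where
  "const_poly c = Poly_Mapping.single 0 c"

definition poly_at :: "(nat \<Rightarrow> real) \<Rightarrow> mpoly \<Rightarrow> real" where
  "poly_at a f =
     (\<Sum>m\<in>Poly_Mapping.keys f.
        Poly_Mapping.lookup f m * (\<Prod>i\<in>Poly_Mapping.keys m. a i ^ Poly_Mapping.lookup m i))"

definition poly_mats :: "nat \<Rightarrow> nat \<Rightarrow> nat \<Rightarrow> mpoly mat set" where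
  "poly_mats p k l = {M \<in> carrier_mat k l. \<forall>i<k. \<forall>j<l. M $$ (i, j) \<in> polys p}"

text \<open>The factor \<open>Y\<close> is square, so for \<open>k = 1\<close> a sum of squares is a single square.\<close>

definition sos_mats :: "nat \<Rightarrow> nat \<Rightarrow> mpoly mat set" where
  "sos_mats p k = {X \<in> poly_mats p k k. \<exists>Y \<in> poly_mats p k k. X = transpose_mat Y * Y}"

definition sos_polys :: "nat \<Rightarrow> mpoly set" where
  "sos_polys p = {w. mat 1 1 (\<lambda>_. w) \<in> sos_mats p 1}"

section \<open>Transfer functions and the $H_\infty$ norm\<close>

text \<open>A transfer function is undefined exactly where the resolvent of the state matrix is.\<close>

type_synonym transfer_function = "complex \<rightharpoonup> complex mat"

definition transfer ::
    "complex mat \<Rightarrow> complex mat \<Rightarrow> complex mat \<Rightarrow> complex mat \<Rightarrow> transfer_function" where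
  "transfer A B C D s =
     map_option (\<lambda>R. C * R * B + D) (mat_inverse (s \<cdot>\<^sub>m 1\<^sub>m (dim_row A) - A))"

definition tf_minus ::
    "transfer_function \<Rightarrow> transfer_function \<Rightarrow> transfer_function" where
  "tf_minus G H s =
     (case (G s, H s) of (Some X, Some Y) \<Rightarrow> Some (X - Y) | _ \<Rightarrow> None)"

definition singular_values :: "complex mat \<Rightarrow> real set" where
  "singular_values M =
     {\<sigma>. 0 \<le> \<sigma> \<and> eigenvalue (mat_adjoint M * M) (complex_of_real (\<sigma>\<^sup>2))}"

text \<open>The inserted \<open>0\<close> matters only for a matrix without columns.\<close>

definition max_singular_value :: "complex mat \<Rightarrow> real" where
  "max_singular_value M = Max (insert 0 (singular_values M))"

text \<open>
  The supremum runs over the points of the open right half plane at which the transfer function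
  is defined. For a transfer function of a finite-dimensional system only finitely many points
  are left out. By continuity a left-out removable singularity does not change the supremum, and
  near a genuine pole in the open right half plane the values are unbounded, so that the norm is
  infinite there, as it should be.
\<close>

definition hinf_norm :: "transfer_function \<Rightarrow> ennreal" where
  "hinf_norm G =
     (SUP s \<in> {s \<in> dom G. Re s > 0}. ennreal (max_singular_value (the (G s))))"

section \<open>Parameter-dependent systems\<close>

definition mat_at :: "(nat \<Rightarrow> real) \<Rightarrow> mpoly mat \<Rightarrow> complex mat" where
  "mat_at a M = map_mat (\<lambda>f. complex_of_real (poly_at a f)) M"

definition transfer_at ::
    "(nat \<Rightarrow> real) \<Rightarrow> mpoly mat \<Rightarrow> mpoly mat \<Rightarrow> mpoly mat \<Rightarrow> mpoly mat \<Rightarrow> transfer_function" where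
  "transfer_at a A B C D = transfer (mat_at a A) (mat_at a B) (mat_at a C) (mat_at a D)"

text \<open>
  The map \<open>T\<close> keeps the first \<open>p'\<close> parameters. Since the reduced parameters are the variables
  \<open>0, \<dots>, p' - 1\<close> themselves, \<open>polys p' \<subseteq> polys p\<close>, and the matrix \<open>A'(T(\<alpha>))\<close> as a
  polynomial matrix in \<open>\<alpha>\<close> is \<open>A'\<close> itself.
\<close>

definition reduce_params :: "nat \<Rightarrow> (nat \<Rightarrow> real) \<Rightarrow> (nat \<Rightarrow> real)" where
  "reduce_params p' a = (\<lambda>i. if i < p' then a i else 0)"

definition append_cols :: "'a :: zero mat \<Rightarrow> 'a mat \<Rightarrow> 'a mat" where
  "append_cols A B = four_block_mat A B (0\<^sub>m 0 (dim_col A)) (0\<^sub>m 0 (dim_col B))"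

definition bounded_real_mat ::
    "mpoly mat \<Rightarrow> mpoly mat \<Rightarrow> mpoly mat \<Rightarrow> mpoly mat \<Rightarrow> mpoly mat \<Rightarrow> real \<Rightarrow> mpoly mat" where
  "bounded_real_mat A B C D P \<gamma> =
     four_block_mat
       (four_block_mat
          (transpose_mat A * P + P * A)  (P * B)
          (transpose_mat B * P)          (- 1\<^sub>m (dim_col B)))
       (transpose_mat C @\<^sub>r transpose_mat D)
       (append_cols C D)
       (- (const_poly (\<gamma>\<^sup>2) \<cdot>\<^sub>m 1\<^sub>m (dim_row C)))"

definition weighted_sum :: "nat \<Rightarrow> nat \<Rightarrow> (nat \<Rightarrow> mpoly mat) \<Rightarrow> (nat \<Rightarrow> mpoly) \<Rightarrow> mpoly mat" where
  "weighted_sum N L Q q = mat N N (\<lambda>ij. \<Sum>l=1..L. Q l $$ ij * q l)"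

end

theory Submission
  imports Defs "Jordan_Normal_Form.Spectral_Radius"
begin

text \<open>
  At a fixed \<open>\<alpha> \<in> \<A>\<close> the certificate says that the bounded real matrix is negative semidefinite.
  For \<open>Re s > 0\<close>, an input \<open>u\<close> and the state \<open>x\<close> with \<open>s x = A x + B u\<close>, \<open>y = C x + D u\<close>, its
  hermitian form at \<open>(x, u, w)\<close> equals
  \<open>2 Re s \<cdot> x\<^sup>* P x + 2 Re (w\<^sup>* y) - |u|\<^sup>2 - \<gamma>\<^sup>2 |w|\<^sup>2\<close>. Taking for \<open>u\<close> a right singular vector
  of the transfer matrix with singular value \<open>\<sigma> > 0\<close>, so that \<open>|y| = \<sigma> |u|\<close>, and \<open>w = y / \<sigma>\<^sup>2\<close>,
  which also covers \<open>\<gamma> = 0\<close>, gives \<open>|u|\<^sup>2 \<le> \<gamma>\<^sup>2 |u|\<^sup>2 / \<sigma>\<^sup>2\<close>.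
\<close>

section \<open>Evaluation of polynomials\<close>

text \<open>Separates exponents from coefficients, so that multiplicativity of evaluation can first
  be proved for monomials alone.\<close>

definition monom_at :: "(nat \<Rightarrow> real) \<Rightarrow> (nat \<Rightarrow>\<^sub>0 nat) \<Rightarrow> real" where
  "monom_at a m = (\<Prod>i\<in>Poly_Mapping.keys m. a i ^ Poly_Mapping.lookup m i)"

text \<open>A variable outside the keys contributes \<open>a i ^ 0 = 1\<close>, even where
  \<open>a i = 0\<close>. Different monomials can thus be compared over one common index
  set.\<close>

lemma monom_at_superset:
  assumes "finite S" "Poly_Mapping.keys m \<subseteq> S"
  shows "monom_at a m = (\<Prod>i\<in>S. a i ^ Poly_Mapping.lookup m i)"
  unfolding monom_at_def using assms
  by (intro prod.mono_neutral_left) (auto simp: in_keys_iff)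

lemma monom_at_0 [simp]: "monom_at a 0 = 1"
  by (simp add: monom_at_def)

lemma monom_at_add: "monom_at a (m + m') = monom_at a m * monom_at a m'"
proof -
  let ?S = "Poly_Mapping.keys m \<union> Poly_Mapping.keys m'"
  have "monom_at a (m + m') = (\<Prod>i\<in>?S. a i ^ Poly_Mapping.lookup (m + m') i)"
    by (intro monom_at_superset) (auto dest: Poly_Mapping.keys_add[THEN subsetD])
  also have "\<dots> = (\<Prod>i\<in>?S. a i ^ Poly_Mapping.lookup m i) * (\<Prod>i\<in>?S. a i ^ Poly_Mapping.lookup m' i)"
    by (simp add: lookup_add power_add prod.distrib)
  also have "\<dots> = monom_at a m * monom_at a m'"
    by (simp add: monom_at_superset[of ?S])
  finally show ?thesis .
qed

text \<open>Monomials may cancel in \<open>f + g\<close>, so its key set can be smaller than the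
  union of the two. Added monomials have coefficient 0, which lets all three sums run over that
  union.\<close>

lemma poly_at_superset:
  assumes "finite S" "Poly_Mapping.keys f \<subseteq> S"
  shows "poly_at a f = (\<Sum>m\<in>S. Poly_Mapping.lookup f m * monom_at a m)"
  unfolding poly_at_def monom_at_def[symmetric] using assms
  by (intro sum.mono_neutral_left) (auto simp: in_keys_iff)

lemma poly_at_add: "poly_at a (f + g) = poly_at a f + poly_at a g"
proof -
  let ?S = "Poly_Mapping.keys f \<union> Poly_Mapping.keys g"
  have "poly_at a (f + g) = (\<Sum>m\<in>?S. Poly_Mapping.lookup (f + g) m * monom_at a m)"
    by (intro poly_at_superset) (auto dest: Poly_Mapping.keys_add[THEN subsetD])
  then show ?thesis
    by (simp add: lookup_add distrib_right sum.distrib poly_at_superset[of ?S])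
qed

lemma poly_at_0 [simp]: "poly_at a 0 = 0"
  by (simp add: poly_at_def)

lemma poly_at_sum: "poly_at a (sum f S) = (\<Sum>i\<in>S. poly_at a (f i))"
  by (induction S rule: infinite_finite_induct) (auto simp: poly_at_add)

lemma poly_at_single: "poly_at a (Poly_Mapping.single m c) = c * monom_at a m"
  by (subst poly_at_superset[of "{m}"]) auto

lemma poly_at_const [simp]: "poly_at a (const_poly c) = c"
  by (simp add: const_poly_def poly_at_single)

lemma poly_at_1 [simp]: "poly_at a 1 = 1"
  using poly_at_const[of a 1] by (simp add: const_poly_def)

text \<open>Serves to reduce the convolution product to products of single terms, which
  \<open>mult_single\<close> computes.\<close>

lemma mpoly_eq_sum_single:
  "f = (\<Sum>m\<in>Poly_Mapping.keys f. Poly_Mapping.single m (Poly_Mapping.lookup f m))"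
  by (rule poly_mapping_eqI)
    (auto simp: lookup_sum lookup_single when_def in_keys_iff)

lemma poly_at_mult: "poly_at a (f * g) = poly_at a f * poly_at a g"
proof -
  have "f * g = (\<Sum>m\<in>Poly_Mapping.keys f. \<Sum>m'\<in>Poly_Mapping.keys g.
      Poly_Mapping.single (m + m') (Poly_Mapping.lookup f m * Poly_Mapping.lookup g m'))"
    using arg_cong2[OF mpoly_eq_sum_single[of f] mpoly_eq_sum_single[of g], of "(*)"]
    unfolding sum_product mult_single .
  \<comment> \<open>Terms with equal \<open>m + m'\<close> need not be collected first, because
    evaluation is additive.\<close>
  then have "poly_at a (f * g) = (\<Sum>m\<in>Poly_Mapping.keys f. \<Sum>m'\<in>Poly_Mapping.keys g.
      (Poly_Mapping.lookup f m * monom_at a m) * (Poly_Mapping.lookup g m' * monom_at a m'))"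
    by (simp add: poly_at_sum poly_at_single monom_at_add mult_ac)
  also have "\<dots> = poly_at a f * poly_at a g"
    by (simp add: sum_product poly_at_superset[OF finite_keys order_refl])
  finally show ?thesis .
qed

text \<open>The target is the complex numbers because \<open>mat_at\<close> takes its entries there.
  The facts on ring homomorphisms then carry matrix products, negation and differences over to
  \<open>mat_at\<close>.\<close>

interpretation poly_at: comm_ring_hom "\<lambda>f. complex_of_real (poly_at a f)" for a
  by unfold_locales (simp_all add: poly_at_add poly_at_mult)

text \<open>Truncation alters \<open>a\<close> only from index \<open>p'\<close> on, and no such
  variable occurs in \<open>f\<close>. This allows the reduced system to be evaluated at \<alpha>
  itself.\<close>

lemma poly_at_reduce_params:
  assumes "f \<in> polys p'"
  shows "poly_at (reduce_params p' a) f = poly_at a f"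
  using assms unfolding poly_at_def polys_def reduce_params_def
  by (intro sum.cong arg_cong2[where f = "(*)"] prod.cong) auto

section \<open>Evaluation of polynomial matrices\<close>

lemma dim_mat_at [simp]: "dim_row (mat_at a M) = dim_row M" "dim_col (mat_at a M) = dim_col M"
  by (simp_all add: mat_at_def)

lemma index_mat_at [simp]:
  "i < dim_row M \<Longrightarrow> j < dim_col M \<Longrightarrow> mat_at a M $$ (i, j) = complex_of_real (poly_at a (M $$ (i, j)))"
  by (simp add: mat_at_def)

lemma mat_at_carrier [simp, intro]: "M \<in> carrier_mat k l \<Longrightarrow> mat_at a M \<in> carrier_mat k l"
  by (simp add: mat_at_def)

lemma mat_at_mult:
  "M \<in> carrier_mat k l \<Longrightarrow> N \<in> carrier_mat l j \<Longrightarrow> mat_at a (M * N) = mat_at a M * mat_at a N"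
  unfolding mat_at_def by (rule poly_at.mat_hom_mult)

lemma mat_at_add:
  "M \<in> carrier_mat k l \<Longrightarrow> N \<in> carrier_mat k l \<Longrightarrow> mat_at a (M + N) = mat_at a M + mat_at a N"
  by (rule eq_matI) (auto simp: poly_at_add)

lemma mat_at_uminus: "mat_at a (- M) = - mat_at a M"
  by (rule eq_matI) (auto simp: poly_at.hom_uminus)

lemma mat_at_minus:
  "M \<in> carrier_mat k l \<Longrightarrow> N \<in> carrier_mat k l \<Longrightarrow> mat_at a (M - N) = mat_at a M - mat_at a N"
  by (rule eq_matI) (auto simp: poly_at.hom_minus)

lemma mat_at_smult: "mat_at a (f \<cdot>\<^sub>m M) = complex_of_real (poly_at a f) \<cdot>\<^sub>m mat_at a M"
  by (rule eq_matI) (auto simp: poly_at_mult)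

lemma mat_at_zero: "mat_at a (0\<^sub>m k l) = 0\<^sub>m k l"
  by (rule eq_matI) auto

lemma mat_at_one: "mat_at a (1\<^sub>m k) = 1\<^sub>m k"
  by (rule eq_matI) auto

lemma mat_at_four_block:
  assumes "M1 \<in> carrier_mat k1 l1" "M2 \<in> carrier_mat k1 l2"
    and "M3 \<in> carrier_mat k2 l1" "M4 \<in> carrier_mat k2 l2"
  shows "mat_at a (four_block_mat M1 M2 M3 M4) =
    four_block_mat (mat_at a M1) (mat_at a M2) (mat_at a M3) (mat_at a M4)"
  unfolding mat_at_def using assms by (rule map_four_block_mat)

lemma mat_at_append_rows:
  "M \<in> carrier_mat k l \<Longrightarrow> N \<in> carrier_mat j l \<Longrightarrow> mat_at a (M @\<^sub>r N) = mat_at a M @\<^sub>r mat_at a N"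
  unfolding append_rows_def
  by (subst mat_at_four_block[of _ k l _ 0 _ j]) (auto simp: mat_at_zero)

lemma append_cols_carrier [simp, intro]:
  "M \<in> carrier_mat k l \<Longrightarrow> N \<in> carrier_mat k j \<Longrightarrow> append_cols M N \<in> carrier_mat k (l + j)"
  unfolding append_cols_def
  using four_block_carrier_mat[of M k l "0\<^sub>m 0 (dim_col N)" 0 j] by simp

lemma mat_at_append_cols:
  "M \<in> carrier_mat k l \<Longrightarrow> N \<in> carrier_mat k j \<Longrightarrow>
   mat_at a (append_cols M N) = append_cols (mat_at a M) (mat_at a N)"
  unfolding append_cols_def
  by (subst mat_at_four_block[of _ k l _ j _ 0]) (auto simp: mat_at_zero)

lemma mat_at_reduce_params:
  "M \<in> poly_mats p' k l \<Longrightarrow> mat_at (reduce_params p' a) M = mat_at a M"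
  by (rule eq_matI) (auto simp: poly_mats_def poly_at_reduce_params)

lemma smult_mat_mult_vec:
  fixes M :: "'a :: comm_semiring_0 mat"
  assumes "M \<in> carrier_mat k l" "x \<in> carrier_vec l"
  shows "(c \<cdot>\<^sub>m M) *\<^sub>v x = c \<cdot>\<^sub>v (M *\<^sub>v x)"
  using assms by (intro eq_vecI) auto

section \<open>Hermitian forms\<close>

lemma mat_adjoint_carrier [simp, intro]:
  "M \<in> carrier_mat k l \<Longrightarrow> mat_adjoint M \<in> carrier_mat l k"
  by (intro carrier_matI) (auto simp: mat_adjoint_def)

lemma dim_mat_adjoint [simp]:
  "dim_row (mat_adjoint M) = dim_col M" "dim_col (mat_adjoint M) = dim_row M"
  by (simp_all add: mat_adjoint_def)

lemma index_mat_adjoint [simp]: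
  assumes "i < dim_col M" "j < dim_row M"
  shows "mat_adjoint M $$ (i, j) = conjugate (M $$ (j, i))"
  using assms by (simp add: mat_adjoint_def mat_of_rows_def)

text \<open>The evaluated entries are real, so conjugation fixes them. This turns the real
  certificate into one about hermitian forms on complex vectors.\<close>

lemma mat_at_transpose: "mat_at a (transpose_mat M) = mat_adjoint (mat_at a M)"
  by (rule eq_matI) auto

text \<open>The product \<open>\<bullet>c\<close> conjugates its second argument. Writing the
  adjoint as the transpose of the entrywise conjugate reduces the claim to the bilinear rule
  \<open>transpose_vec_mult_scalar\<close>.\<close>

lemma cscalar_prod_mat_adjoint:
  fixes M :: "complex mat"
  assumes M: "M \<in> carrier_mat k l" and x: "x \<in> carrier_vec l" and y: "y \<in> carrier_vec k"
  shows "(mat_adjoint M *\<^sub>v y) \<bullet>c x = y \<bullet>c (M *\<^sub>v x)"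
proof -
  have eq: "mat_adjoint M = transpose_mat (map_mat cnj M)"
    by (rule eq_matI) auto
  have "conjugate (M *\<^sub>v x) = map_mat cnj M *\<^sub>v conjugate x"
    using M x by (intro eq_vecI) (auto simp: scalar_prod_def)
  moreover have "(mat_adjoint M *\<^sub>v y) \<bullet>c x = y \<bullet> (map_mat cnj M *\<^sub>v conjugate x)"
    unfolding eq using M x y by (intro transpose_vec_mult_scalar) auto
  ultimately show ?thesis by simp
qed

lemma cscalar_prod_self:
  fixes x :: "complex vec"
  shows "x \<bullet>c x = complex_of_real (\<Sum>i<dim_vec x. (cmod (x $ i))\<^sup>2)"
  by (simp add: scalar_prod_def lessThan_atLeast0 flip: complex_norm_square)

lemma cscalar_prod_self_ge_0: "0 \<le> Re (x \<bullet>c x)" for x :: "complex vec"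
  unfolding cscalar_prod_self by (simp add: sum_nonneg)

lemma cscalar_prod_self_gt_0:
  fixes x :: "complex vec"
  assumes "x \<in> carrier_vec k" "x \<noteq> 0\<^sub>v k"
  shows "0 < Re (x \<bullet>c x)"
proof -
  obtain i where i: "i < dim_vec x" "x $ i \<noteq> 0"
    using assms by (metis carrier_vecD eq_vecI index_zero_vec)
  then have "0 < (\<Sum>i<dim_vec x. (cmod (x $ i))\<^sup>2)"
    by (intro sum_pos2[where i = i]) auto
  then show ?thesis unfolding cscalar_prod_self by simp
qed

lemma cscalar_prod_commute:
  fixes x y :: "complex vec"
  assumes "x \<in> carrier_vec k" "y \<in> carrier_vec k"
  shows "x \<bullet>c y = cnj (y \<bullet>c x)"
  using assms by (simp add: scalar_prod_def mult.commute)

text \<open>The test vectors are complex because states and inputs at a complex frequency are.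
  Taking the real part yields a real inequality that is stable under sums and nonnegative
  multiples.\<close>

definition psd_form :: "nat \<Rightarrow> complex mat \<Rightarrow> bool" where
  "psd_form k M \<longleftrightarrow> M \<in> carrier_mat k k \<and> (\<forall>x\<in>carrier_vec k. 0 \<le> Re ((M *\<^sub>v x) \<bullet>c x))"

lemma psd_form_zero: "psd_form k (0\<^sub>m k k)"
  by (auto simp: psd_form_def scalar_prod_def)

lemma psd_form_one: "psd_form k (1\<^sub>m k)"
  by (auto simp: psd_form_def cscalar_prod_self_ge_0)

lemma psd_form_uminusD:
  assumes "psd_form k (- M)" "x \<in> carrier_vec k"
  shows "Re ((M *\<^sub>v x) \<bullet>c x) \<le> 0"
proof -
  have M: "dim_row M = k" "dim_col M = k"
    using assms(1) by (auto simp: psd_form_def dest: carrier_matD)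
  then have "(- M *\<^sub>v x) \<bullet>c x = - ((M *\<^sub>v x) \<bullet>c x)"
    using assms(2) by simp
  then show ?thesis using assms by (auto simp: psd_form_def)
qed

lemma psd_form_add:
  assumes "psd_form k M" "psd_form k N"
  shows "psd_form k (M + N)"
  unfolding psd_form_def
proof (intro conjI ballI)
  fix x :: "complex vec" assume x: "x \<in> carrier_vec k"
  have MN: "M \<in> carrier_mat k k" "N \<in> carrier_mat k k" using assms by (auto simp: psd_form_def)
  have "((M + N) *\<^sub>v x) \<bullet>c x = (M *\<^sub>v x) \<bullet>c x + (N *\<^sub>v x) \<bullet>c x"
    using MN x by (simp add: add_mult_distrib_mat_vec[of _ k k] add_scalar_prod_distrib[of _ k])
  then show "0 \<le> Re (((M + N) *\<^sub>v x) \<bullet>c x)" using assms x by (simp add: psd_form_def)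
qed (use assms in \<open>auto simp: psd_form_def\<close>)

lemma psd_form_smult:
  assumes "psd_form k M" "0 \<le> c"
  shows "psd_form k (complex_of_real c \<cdot>\<^sub>m M)"
  unfolding psd_form_def
proof (intro conjI ballI)
  fix x :: "complex vec" assume x: "x \<in> carrier_vec k"
  have M: "M \<in> carrier_mat k k" using assms by (auto simp: psd_form_def)
  have "((complex_of_real c \<cdot>\<^sub>m M) *\<^sub>v x) \<bullet>c x = complex_of_real c * ((M *\<^sub>v x) \<bullet>c x)"
    using M x by (subst smult_mat_mult_vec[of _ k k]) auto
  then show "0 \<le> Re (((complex_of_real c \<cdot>\<^sub>m M) *\<^sub>v x) \<bullet>c x)" using assms x by (simp add: psd_form_def)
qed (use assms in \<open>auto simp: psd_form_def\<close>)

text \<open>The form at \<open>x\<close> is the squared norm of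
  \<open>Y *\<^sub>v x\<close>.\<close>

lemma psd_form_gram:
  assumes "Y \<in> carrier_mat l k"
  shows "psd_form k (mat_adjoint Y * Y)"
  unfolding psd_form_def
proof (intro conjI ballI)
  fix x :: "complex vec" assume x: "x \<in> carrier_vec k"
  have "((mat_adjoint Y * Y) *\<^sub>v x) \<bullet>c x = (Y *\<^sub>v x) \<bullet>c (Y *\<^sub>v x)"
    using assms x by (simp add: assoc_mult_mat_vec[of _ k l _ k] cscalar_prod_mat_adjoint[of _ l k])
  then show "0 \<le> Re (((mat_adjoint Y * Y) *\<^sub>v x) \<bullet>c x)" by (simp add: cscalar_prod_self_ge_0)
qed (use assms in auto)

text \<open>The factorization survives evaluation, and at a real point the transposed factor becomes
  the adjoint, which leaves a Gram matrix.\<close>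

lemma psd_form_sos_mats:
  assumes "X \<in> sos_mats p k"
  shows "psd_form k (mat_at a X)"
proof -
  obtain Y where Y: "Y \<in> carrier_mat k k" "X = transpose_mat Y * Y"
    using assms by (auto simp: sos_mats_def poly_mats_def)
  then show ?thesis
    by (auto simp: mat_at_mult[of _ k k] mat_at_transpose intro!: psd_form_gram)
qed

text \<open>Turns the entrywise definition into a matrix sum with a scalar multiple, the operations
  under which \<open>psd_form\<close> is closed.\<close>

lemma mat_at_weighted_sum_Suc:
  assumes "Q (Suc L) \<in> carrier_mat k k"
  shows "mat_at a (weighted_sum k (Suc L) Q q) =
    mat_at a (weighted_sum k L Q q) + complex_of_real (poly_at a (q (Suc L))) \<cdot>\<^sub>m mat_at a (Q (Suc L))"
  using assms by (intro eq_matI) (auto simp: weighted_sum_def poly_at_add poly_at_mult)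

text \<open>Here the constraints on the parameters enter: nonnegative values of the
  \<open>q l\<close> make each summand a nonnegative multiple of a semidefinite matrix.\<close>

lemma psd_form_weighted_sum:
  assumes "\<And>l. l \<in> {1..L} \<Longrightarrow> Q l \<in> sos_mats p k" "\<And>l. l \<in> {1..L} \<Longrightarrow> 0 \<le> poly_at a (q l)"
  shows "psd_form k (mat_at a (weighted_sum k L Q q))"
  using assms
proof (induction L)
  case 0
  have "mat_at a (weighted_sum k 0 Q q) = 0\<^sub>m k k" by (rule eq_matI) (auto simp: weighted_sum_def)
  then show ?case by (simp add: psd_form_zero)
next
  case (Suc L)
  have Q: "Q (Suc L) \<in> sos_mats p k" using Suc.prems by simp
  then have "Q (Suc L) \<in> carrier_mat k k" by (auto simp: sos_mats_def poly_mats_def)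
  moreover have "psd_form k (mat_at a (weighted_sum k L Q q))" using Suc by simp
  ultimately show ?case
    using Q Suc.prems(2)[of "Suc L"]
    by (simp add: mat_at_weighted_sum_Suc psd_form_add psd_form_smult psd_form_sos_mats)
qed

section \<open>Block matrices acting on stacked vectors\<close>

lemma append_cols_mult_vec:
  assumes M: "M \<in> carrier_mat k l" and N: "N \<in> carrier_mat k j"
    and x: "x \<in> carrier_vec l" and y: "y \<in> carrier_vec j"
  shows "append_cols M N *\<^sub>v (x @\<^sub>v y) = M *\<^sub>v x + N *\<^sub>v y"
proof -
  \<comment> \<open>The lower blocks have no rows, so the second part of the result is the empty
    vector.\<close>
  have "append_cols M N *\<^sub>v (x @\<^sub>v y) =
    (M *\<^sub>v x + N *\<^sub>v y) @\<^sub>v (0\<^sub>m 0 l *\<^sub>v x + 0\<^sub>m 0 j *\<^sub>v y)"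
    unfolding append_cols_def using M N x y
    by (subst four_block_mat_mult_vec[of M k l N j _ 0]) auto
  also have "\<dots> = M *\<^sub>v x + N *\<^sub>v y"
    using M N by (intro eq_vecI) auto
  finally show ?thesis .
qed

lemma cscalar_prod_append:
  fixes v1 v2 w1 w2 :: "complex vec"
  assumes "v1 \<in> carrier_vec k" "v2 \<in> carrier_vec l" "w1 \<in> carrier_vec k" "w2 \<in> carrier_vec l"
  shows "(v1 @\<^sub>v v2) \<bullet>c (w1 @\<^sub>v w2) = v1 \<bullet>c w1 + v2 \<bullet>c w2"
proof -
  have "conjugate (w1 @\<^sub>v w2) = conjugate w1 @\<^sub>v conjugate w2"
    by (rule eq_vecI) auto
  then show ?thesis
    using assms by (simp add: scalar_prod_append[of _ k _ l])
qed

section \<open>The bounded real inequality\<close>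

text \<open>The state equation is used twice, once behind \<open>P\<close> and once, after moving
  adjoints, in the conjugated argument. The two uses contribute \<open>s\<close> and
  \<open>cnj s\<close> times the form of \<open>P\<close>, which is where \<open>2 * Re s\<close>
  comes from. Here \<open>g\<close> stands for \<open>\<gamma>\<^sup>2\<close>.\<close>

lemma bounded_real_form:
  fixes A B C D P :: "complex mat" and g :: real
  assumes A: "A \<in> carrier_mat k k" and B: "B \<in> carrier_mat k m"
    and C: "C \<in> carrier_mat r k" and D: "D \<in> carrier_mat r m" and P: "P \<in> carrier_mat k k"
    and x: "x \<in> carrier_vec k" and u: "u \<in> carrier_vec m" and w: "w \<in> carrier_vec r"
    and state: "s \<cdot>\<^sub>v x = A *\<^sub>v x + B *\<^sub>v u"
  defines "F \<equiv> four_block_mat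
      (four_block_mat (mat_adjoint A * P + P * A) (P * B) (mat_adjoint B * P) (- 1\<^sub>m m))
      (mat_adjoint C @\<^sub>r mat_adjoint D) (append_cols C D) (- (complex_of_real g \<cdot>\<^sub>m 1\<^sub>m r))"
    and "z \<equiv> (x @\<^sub>v u) @\<^sub>v w"
  shows "Re ((F *\<^sub>v z) \<bullet>c z) = 2 * Re s * Re ((P *\<^sub>v x) \<bullet>c x)
    + 2 * Re ((C *\<^sub>v x + D *\<^sub>v u) \<bullet>c w) - Re (u \<bullet>c u) - g * Re (w \<bullet>c w)"
proof -
  let ?a = "mat_adjoint A *\<^sub>v (P *\<^sub>v x)" and ?b = "mat_adjoint B *\<^sub>v (P *\<^sub>v x)"
  let ?c = "mat_adjoint C *\<^sub>v w" and ?d = "mat_adjoint D *\<^sub>v w" and ?y = "C *\<^sub>v x + D *\<^sub>v u"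
  let ?p = "(P *\<^sub>v x) \<bullet>c x"
  have carr [simp]: "?a \<in> carrier_vec k" "?b \<in> carrier_vec m" "?c \<in> carrier_vec k"
    "?d \<in> carrier_vec m" "?y \<in> carrier_vec r" "P *\<^sub>v x \<in> carrier_vec k"
    "A *\<^sub>v x \<in> carrier_vec k" "B *\<^sub>v u \<in> carrier_vec k"
    "C *\<^sub>v x \<in> carrier_vec r" "D *\<^sub>v u \<in> carrier_vec r"
    "P *\<^sub>v (A *\<^sub>v x) \<in> carrier_vec k" "P *\<^sub>v (B *\<^sub>v u) \<in> carrier_vec k"
    using A B C D P x u w by (auto intro!: mult_mat_vec_carrier add_carrier_vec)
  \<comment> \<open>First use of the state equation: the terms with \<open>P * A\<close> and
    \<open>P * B\<close> in the top row merge.\<close>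
  have "P *\<^sub>v (A *\<^sub>v x) + P *\<^sub>v (B *\<^sub>v u) = P *\<^sub>v (s \<cdot>\<^sub>v x)"
    unfolding state using P by (simp add: mult_add_distrib_mat_vec[of P k k])
  also have "\<dots> = s \<cdot>\<^sub>v (P *\<^sub>v x)" using P x by (rule mult_mat_vec)
  finally have PAB: "P *\<^sub>v (A *\<^sub>v x) + P *\<^sub>v (B *\<^sub>v u) = s \<cdot>\<^sub>v (P *\<^sub>v x)" .
  have "(mat_adjoint A * P + P * A) *\<^sub>v x + (P * B) *\<^sub>v u =
      ?a + (P *\<^sub>v (A *\<^sub>v x) + P *\<^sub>v (B *\<^sub>v u))"
    using A B P x u
    by (subst add_mult_distrib_mat_vec[of _ k k])
      (auto simp: assoc_mult_mat_vec[of _ k k _ k] assoc_mult_mat_vec[of _ k k _ m]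
        assoc_add_vec[of _ k])
  then have row1: "(mat_adjoint A * P + P * A) *\<^sub>v x + (P * B) *\<^sub>v u = ?a + s \<cdot>\<^sub>v (P *\<^sub>v x)"
    by (simp add: PAB)
  have row2: "(mat_adjoint B * P) *\<^sub>v x + (- 1\<^sub>m m) *\<^sub>v u = ?b - u"
    using B P x u by (simp add: assoc_mult_mat_vec[of _ m k _ k] minus_add_uminus_vec[of _ m])
  have row3: "(- (complex_of_real g \<cdot>\<^sub>m 1\<^sub>m r)) *\<^sub>v w = - (complex_of_real g \<cdot>\<^sub>v w)"
    using w by (simp add: smult_mat_mult_vec[of _ r r])
  have xu: "x @\<^sub>v u \<in> carrier_vec (k + m)" using x u by simp
  have carr1: "four_block_mat (mat_adjoint A * P + P * A) (P * B) (mat_adjoint B * P) (- 1\<^sub>m m)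
      \<in> carrier_mat (k + m) (k + m)"
    using A B P by (intro four_block_carrier_mat) auto
  have carr2: "mat_adjoint C @\<^sub>r mat_adjoint D \<in> carrier_mat (k + m) r"
    using C D by (intro carrier_append_rows) auto
  have carr3: "append_cols C D \<in> carrier_mat r (k + m)" using C D by auto
  have carr4: "- (complex_of_real g \<cdot>\<^sub>m 1\<^sub>m r) \<in> carrier_mat r r" by auto
  \<comment> \<open>The nested block matrix is applied from the inside out: first the blocks acting
    on state and input, then the row and column belonging to \<open>w\<close>.\<close>
  have inner: "four_block_mat (mat_adjoint A * P + P * A) (P * B) (mat_adjoint B * P) (- 1\<^sub>m m)
      *\<^sub>v (x @\<^sub>v u) = (?a + s \<cdot>\<^sub>v (P *\<^sub>v x)) @\<^sub>v (?b - u)"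
    using A B P x u
    by (subst four_block_mat_mult_vec[of _ k k _ m _ m]) (auto simp only: row1 row2, auto)
  have "F *\<^sub>v z = (((?a + s \<cdot>\<^sub>v (P *\<^sub>v x)) @\<^sub>v (?b - u)) + (?c @\<^sub>v ?d)) @\<^sub>v (?y + - (complex_of_real g \<cdot>\<^sub>v w))"
    unfolding F_def z_def
    using C D x u w
    by (subst four_block_mat_mult_vec[OF carr1 carr2 carr3 carr4 xu w])
      (simp only: inner row3 append_cols_mult_vec[OF C D x u]
        mat_mult_append[OF mat_adjoint_carrier[OF C] mat_adjoint_carrier[OF D] w])
  also have "\<dots> = ((?a + s \<cdot>\<^sub>v (P *\<^sub>v x) + ?c) @\<^sub>v (?b - u + ?d)) @\<^sub>v (?y + - (complex_of_real g \<cdot>\<^sub>v w))"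
    using u by (subst append_vec_add[of _ k _ _ m]) auto
  finally have Fz: "F *\<^sub>v z = \<dots>" .
  have "(F *\<^sub>v z) \<bullet>c z = (?a + s \<cdot>\<^sub>v (P *\<^sub>v x) + ?c) \<bullet>c x + (?b - u + ?d) \<bullet>c u
      + (?y + - (complex_of_real g \<cdot>\<^sub>v w)) \<bullet>c w"
    unfolding Fz unfolding z_def
    using x u w by (subst cscalar_prod_append[of _ "k + m" _ r], simp_all)
      (subst cscalar_prod_append[of _ k _ m], simp_all)
  also have "\<dots> = ?a \<bullet>c x + s * ?p + ?c \<bullet>c x + (?b \<bullet>c u - u \<bullet>c u + ?d \<bullet>c u)
      + (?y \<bullet>c w - complex_of_real g * (w \<bullet>c w))"
    using P x u w
    by (simp add: add_scalar_prod_distrib[of _ k] add_scalar_prod_distrib[of _ m]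
        add_scalar_prod_distrib[of ?y r] minus_scalar_prod_distrib[of _ m])
  \<comment> \<open>All adjoints are moved to the second argument, where \<open>A\<close>,
    \<open>B\<close> and \<open>C\<close>, \<open>D\<close> meet \<open>x\<close> and
    \<open>u\<close> again.\<close>
  also have "\<dots> = ((P *\<^sub>v x) \<bullet>c (A *\<^sub>v x) + (P *\<^sub>v x) \<bullet>c (B *\<^sub>v u)) + s * ?p
      + (w \<bullet>c (C *\<^sub>v x) + w \<bullet>c (D *\<^sub>v u)) - u \<bullet>c u + ?y \<bullet>c w - complex_of_real g * (w \<bullet>c w)"
    using x u w by (simp add: cscalar_prod_mat_adjoint[OF A] cscalar_prod_mat_adjoint[OF B]
        cscalar_prod_mat_adjoint[OF C] cscalar_prod_mat_adjoint[OF D])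
  \<comment> \<open>Second use of the state equation, now in the argument that gets conjugated; this
    produces \<open>cnj s\<close>.\<close>
  also have "(P *\<^sub>v x) \<bullet>c (A *\<^sub>v x) + (P *\<^sub>v x) \<bullet>c (B *\<^sub>v u) = (P *\<^sub>v x) \<bullet>c (s \<cdot>\<^sub>v x)"
    unfolding state by (subst conjugate_add_vec[of _ k]) (simp_all add: scalar_prod_add_distrib[of _ k])
  also have "\<dots> = cnj s * ?p"
    using x P by (simp add: conjugate_smult_vec)
  also have "w \<bullet>c (C *\<^sub>v x) + w \<bullet>c (D *\<^sub>v u) = w \<bullet>c ?y"
    using w by (subst conjugate_add_vec[of _ r]) (simp_all add: scalar_prod_add_distrib[of _ r])
  also have "\<dots> = cnj (?y \<bullet>c w)" using w by (intro cscalar_prod_commute[of _ r]) auto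
  finally have "(F *\<^sub>v z) \<bullet>c z = cnj s * ?p + s * ?p + cnj (?y \<bullet>c w) - u \<bullet>c u + ?y \<bullet>c w
      - complex_of_real g * (w \<bullet>c w)" .
  \<comment> \<open>The factors \<open>s\<close> and \<open>cnj s\<close> add up to the real number
    \<open>2 * Re s\<close>, and the two cross terms with \<open>w\<close> are conjugate to each
    other.\<close>
  from arg_cong[OF this, of Re] show ?thesis by (simp add: algebra_simps)
qed

section \<open>Transfer matrices and their states\<close>

lemma transfer_state:
  fixes A B C D :: "complex mat"
  assumes A: "A \<in> carrier_mat k k" and B: "B \<in> carrier_mat k m"
    and C: "C \<in> carrier_mat r k" and D: "D \<in> carrier_mat r m"
    and X: "transfer A B C D s = Some X" and u: "u \<in> carrier_vec m"
  obtains x where "x \<in> carrier_vec k" "s \<cdot>\<^sub>v x = A *\<^sub>v x + B *\<^sub>v u" "X *\<^sub>v u = C *\<^sub>v x + D *\<^sub>v u"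
proof -
  obtain R where R: "mat_inverse (s \<cdot>\<^sub>m 1\<^sub>m k - A) = Some R" and X_eq: "X = C * R * B + D"
    using X A by (auto simp: transfer_def)
  have S: "s \<cdot>\<^sub>m 1\<^sub>m k - A \<in> carrier_mat k k" using A by auto
  from mat_inverse(2)[OF S R] have inv: "(s \<cdot>\<^sub>m 1\<^sub>m k - A) * R = 1\<^sub>m k" and Rc: "R \<in> carrier_mat k k" by auto
  \<comment> \<open>The resolvent exists since the transfer function is defined at \<open>s\<close>;
    applied to the driven input it gives the state.\<close>
  define x where "x = R *\<^sub>v (B *\<^sub>v u)"
  have Bu: "B *\<^sub>v u \<in> carrier_vec k" using B u by auto
  have x: "x \<in> carrier_vec k" unfolding x_def using Rc Bu by auto
  have "B *\<^sub>v u = ((s \<cdot>\<^sub>m 1\<^sub>m k - A) * R) *\<^sub>v (B *\<^sub>v u)" using Bu by (simp add: inv)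
  also have "\<dots> = (s \<cdot>\<^sub>m 1\<^sub>m k - A) *\<^sub>v x" unfolding x_def using S Rc Bu by (rule assoc_mult_mat_vec)
  also have "\<dots> = s \<cdot>\<^sub>v x - A *\<^sub>v x"
    using A x by (subst minus_mult_distrib_mat_vec[of _ k k]) (simp_all add: smult_mat_mult_vec[of _ k k])
  finally have Bu_eq: "B *\<^sub>v u = s \<cdot>\<^sub>v x - A *\<^sub>v x" .
  have "s \<cdot>\<^sub>v x = A *\<^sub>v x + B *\<^sub>v u"
    unfolding Bu_eq using A x by (intro eq_vecI) auto
  moreover have "X *\<^sub>v u = C *\<^sub>v x + D *\<^sub>v u"
    unfolding X_eq x_def using B C D Rc u Bu
    by (simp add: add_mult_distrib_mat_vec[of _ r m] assoc_mult_mat_vec[of _ r k _ m])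
  ultimately show ?thesis using that x by blast
qed

lemma transfer_carrier:
  assumes "A \<in> carrier_mat k k" "B \<in> carrier_mat k m" "C \<in> carrier_mat r k" "D \<in> carrier_mat r m"
    and "transfer A B C D s = Some X"
  shows "X \<in> carrier_mat r m"
  using assms by (auto simp: transfer_def)

section \<open>Singular values\<close>

lemma max_singular_value_le:
  assumes M: "M \<in> carrier_mat r m" and "0 \<le> c"
    and le: "\<And>\<sigma>. \<sigma> \<in> singular_values M \<Longrightarrow> \<sigma> \<le> c"
  shows "max_singular_value M \<le> c"
proof -
  \<comment> \<open>\<open>Max\<close> is meaningful only on a finite set. Finiteness comes from the
    spectrum, into which squaring embeds the singular values.\<close>
  have "finite (spectrum (mat_adjoint M * M))"
    using M by (intro card_finite_spectrum(1)[of _ m]) auto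
  moreover have "(\<lambda>\<sigma>. complex_of_real (\<sigma>\<^sup>2)) ` singular_values M \<subseteq> spectrum (mat_adjoint M * M)"
    by (auto simp: singular_values_def spectrum_def)
  \<comment> \<open>Squaring is injective here because singular values are nonnegative by
    definition.\<close>
  moreover have "inj_on (\<lambda>\<sigma>. complex_of_real (\<sigma>\<^sup>2)) (singular_values M)"
    by (auto simp: inj_on_def singular_values_def simp del: of_real_power)
  ultimately have "finite (singular_values M)" by (meson finite_imageD finite_subset)
  then show ?thesis using assms by (auto simp: max_singular_value_def)
qed

text \<open>An eigenvector of \<open>mat_adjoint M * M\<close> serves as right singular vector;
  moving the adjoint across the product turns its eigenvalue into the ratio of squared
  norms.\<close>

lemma singular_value_vector:
  assumes M: "M \<in> carrier_mat r m" and \<sigma>: "\<sigma> \<in> singular_values M"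
  obtains u where "u \<in> carrier_vec m" "0 < Re (u \<bullet>c u)"
    "Re ((M *\<^sub>v u) \<bullet>c (M *\<^sub>v u)) = \<sigma>\<^sup>2 * Re (u \<bullet>c u)"
proof -
  obtain u where u: "u \<in> carrier_vec m" "u \<noteq> 0\<^sub>v m"
    and ev: "(mat_adjoint M * M) *\<^sub>v u = complex_of_real (\<sigma>\<^sup>2) \<cdot>\<^sub>v u"
    using M \<sigma> by (auto simp: singular_values_def eigenvalue_def eigenvector_def)
  have "(M *\<^sub>v u) \<bullet>c (M *\<^sub>v u) = ((mat_adjoint M * M) *\<^sub>v u) \<bullet>c u"
    using M u by (simp add: assoc_mult_mat_vec[of _ m r _ m] cscalar_prod_mat_adjoint[of _ r m])
  also have "\<dots> = complex_of_real (\<sigma>\<^sup>2) * (u \<bullet>c u)" unfolding ev using u by simp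
  finally have "Re ((M *\<^sub>v u) \<bullet>c (M *\<^sub>v u)) = \<sigma>\<^sup>2 * Re (u \<bullet>c u)" by (simp del: of_real_power)
  then show ?thesis using that u cscalar_prod_self_gt_0 by blast
qed

section \<open>The certificate at a fixed parameter\<close>

lemma mat_at_bounded_real_mat:
  assumes A: "A \<in> carrier_mat k k" and B: "B \<in> carrier_mat k m"
    and C: "C \<in> carrier_mat r k" and D: "D \<in> carrier_mat r m" and P: "P \<in> carrier_mat k k"
  shows "mat_at a (bounded_real_mat A B C D P \<gamma>) = four_block_mat
      (four_block_mat (mat_adjoint (mat_at a A) * mat_at a P + mat_at a P * mat_at a A)
        (mat_at a P * mat_at a B) (mat_adjoint (mat_at a B) * mat_at a P) (- 1\<^sub>m m))
      (mat_adjoint (mat_at a C) @\<^sub>r mat_adjoint (mat_at a D))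
      (append_cols (mat_at a C) (mat_at a D)) (- (complex_of_real (\<gamma>\<^sup>2) \<cdot>\<^sub>m 1\<^sub>m r))"
proof -
  have [simp]: "dim_col B = m" "dim_row C = r" using B C by auto
  have 1: "transpose_mat A * P + P * A \<in> carrier_mat k k" "P * B \<in> carrier_mat k m"
    "transpose_mat B * P \<in> carrier_mat m k" "- 1\<^sub>m m \<in> carrier_mat m m"
    using A B P by auto
  have 2: "transpose_mat C @\<^sub>r transpose_mat D \<in> carrier_mat (k + m) r"
    using C D by (intro carrier_append_rows) auto
  have 3: "append_cols C D \<in> carrier_mat r (k + m)" using C D by auto
  have 4: "- (const_poly (\<gamma>\<^sup>2) \<cdot>\<^sub>m 1\<^sub>m r) \<in> carrier_mat r r" by auto
  have "mat_at a (transpose_mat A * P + P * A) =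
      mat_adjoint (mat_at a A) * mat_at a P + mat_at a P * mat_at a A"
    using A P by (subst mat_at_add[of _ k k]) (auto simp: mat_at_mult[of _ k k] mat_at_transpose)
  moreover have "mat_at a (transpose_mat B * P) = mat_adjoint (mat_at a B) * mat_at a P"
    using B P by (subst mat_at_mult[of _ m k _ k]) (auto simp: mat_at_transpose)
  moreover have "mat_at a (P * B) = mat_at a P * mat_at a B"
    using B P by (rule mat_at_mult[rotated])
  moreover have "mat_at a (transpose_mat C @\<^sub>r transpose_mat D) =
      mat_adjoint (mat_at a C) @\<^sub>r mat_adjoint (mat_at a D)"
    using C D by (subst mat_at_append_rows[of _ k r]) (auto simp: mat_at_transpose)
  ultimately show ?thesis
    unfolding bounded_real_mat_def
    by (simp add: mat_at_four_block[OF four_block_carrier_mat[OF 1(1,4)] 2 3 4]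
        mat_at_four_block[OF 1] mat_at_append_cols[OF C D] mat_at_uminus mat_at_one mat_at_smult
        del: of_real_power)
qed

text \<open>Solving the identity for \<open>- F\<close> leaves a sum of a multiple of the unit
  matrix, a sum of squares and the weighted sum, each semidefinite at \<open>a\<close>.\<close>

lemma psd_form_bounded_real_mat:
  assumes F: "F \<in> carrier_mat N N"
    and eq: "F + const_poly \<epsilon> \<cdot>\<^sub>m 1\<^sub>m N + Q 0 + weighted_sum N L Q q = 0\<^sub>m N N"
    and \<epsilon>: "0 \<le> \<epsilon>" and Q: "\<And>l. l \<in> {0..L} \<Longrightarrow> Q l \<in> sos_mats p N"
    and q: "\<And>l. l \<in> {1..L} \<Longrightarrow> 0 \<le> poly_at a (q l)"
  shows "psd_form N (- mat_at a F)"
proof -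
  let ?S = "complex_of_real \<epsilon> \<cdot>\<^sub>m 1\<^sub>m N + mat_at a (Q 0) + mat_at a (weighted_sum N L Q q)"
  have Q0: "Q 0 \<in> sos_mats p N" using Q by simp
  then have Q0c: "Q 0 \<in> carrier_mat N N" by (auto simp: sos_mats_def poly_mats_def)
  have W: "weighted_sum N L Q q \<in> carrier_mat N N" by (simp add: weighted_sum_def)
  have "psd_form N ?S"
    using \<epsilon> Q Q0 q by (intro psd_form_add psd_form_smult psd_form_one psd_form_sos_mats
        psd_form_weighted_sum[of _ _ p]) auto
  moreover have "- mat_at a F = ?S"
  proof (rule eq_matI)
    fix i j assume ij: "i < dim_row ?S" "j < dim_col ?S"
    then have "i < N" "j < N" using W by auto
    \<comment> \<open>The identity holds between polynomials, so it is read off entrywise and then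
      evaluated. The later split on \<open>i = j\<close> settles the entries of the unit
      matrix.\<close>
    moreover from this have "(F + const_poly \<epsilon> \<cdot>\<^sub>m 1\<^sub>m N + Q 0 + weighted_sum N L Q q) $$ (i, j) = 0"
      unfolding eq by simp
    then have "complex_of_real (poly_at a ((F + const_poly \<epsilon> \<cdot>\<^sub>m 1\<^sub>m N + Q 0 + weighted_sum N L Q q) $$ (i, j))) = 0"
      by simp
    ultimately show "(- mat_at a F) $$ (i, j) = ?S $$ (i, j)"
      using F W Q0c by (cases "i = j")
        (simp_all add: poly_at_add poly_at_mult add.assoc neg_eq_iff_add_eq_0 flip: of_real_add)
  qed (use F W in auto)
  ultimately show ?thesis by simp
qed

text \<open>\<open>Z\<close> is tied to the system only through the existence of states. This fits
  \<open>tf_minus\<close>, which subtracts pointwise: the difference never has to be rewritten as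
  one transfer function of the block system.\<close>

lemma singular_value_le_of_bounded_real:
  fixes A B C D P Z :: "complex mat" and g :: real
  assumes A: "A \<in> carrier_mat k k" and B: "B \<in> carrier_mat k m"
    and C: "C \<in> carrier_mat r k" and D: "D \<in> carrier_mat r m" and P: "psd_form k P"
    and Z: "Z \<in> carrier_mat r m" and s: "0 \<le> Re s" and \<gamma>: "0 \<le> \<gamma>"
    and state: "\<And>u. u \<in> carrier_vec m \<Longrightarrow>
      \<exists>x\<in>carrier_vec k. s \<cdot>\<^sub>v x = A *\<^sub>v x + B *\<^sub>v u \<and> Z *\<^sub>v u = C *\<^sub>v x + D *\<^sub>v u"
    and lmi: "psd_form (k + m + r) (- four_block_mat
      (four_block_mat (mat_adjoint A * P + P * A) (P * B) (mat_adjoint B * P) (- 1\<^sub>m m))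
      (mat_adjoint C @\<^sub>r mat_adjoint D) (append_cols C D)
      (- (complex_of_real (\<gamma>\<^sup>2) \<cdot>\<^sub>m 1\<^sub>m r)))" (is "psd_form _ (- ?F)")
    and \<sigma>: "\<sigma> \<in> singular_values Z"
  shows "\<sigma> \<le> \<gamma>"
proof (cases "\<sigma> = 0")
  case False
  have \<sigma>_pos: "0 < \<sigma>" using False \<sigma> by (simp add: singular_values_def)
  obtain u where u: "u \<in> carrier_vec m" "0 < Re (u \<bullet>c u)"
    and Zu: "Re ((Z *\<^sub>v u) \<bullet>c (Z *\<^sub>v u)) = \<sigma>\<^sup>2 * Re (u \<bullet>c u)"
    using singular_value_vector[OF Z \<sigma>] by blast
  obtain x where x: "x \<in> carrier_vec k" "s \<cdot>\<^sub>v x = A *\<^sub>v x + B *\<^sub>v u"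
    and y: "Z *\<^sub>v u = C *\<^sub>v x + D *\<^sub>v u" using state[OF u(1)] by blast
  define U where "U = Re (u \<bullet>c u)"
  \<comment> \<open>With \<open>y = Z *\<^sub>v u\<close> this scaling makes
    \<open>Re (y \<bullet>c w)\<close> equal to \<open>U\<close> and
    \<open>Re (w \<bullet>c w)\<close> equal to \<open>U / \<sigma>\<^sup>2\<close>. The scaling by
    \<open>1 / \<gamma>\<^sup>2\<close>, which maximizes the form for positive \<gamma>, would break
    down at \<gamma> = 0.\<close>
  define w where "w = complex_of_real (1 / \<sigma>\<^sup>2) \<cdot>\<^sub>v (Z *\<^sub>v u)"
  have Zc: "Z *\<^sub>v u \<in> carrier_vec r" using Z u by auto
  have w: "w \<in> carrier_vec r" using Zc by (simp add: w_def)
  have cw: "conjugate w = complex_of_real (1 / \<sigma>\<^sup>2) \<cdot>\<^sub>v conjugate (Z *\<^sub>v u)"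
    unfolding w_def by (subst conjugate_smult_vec) simp
  have Zw: "(Z *\<^sub>v u) \<bullet>c w = complex_of_real (1 / \<sigma>\<^sup>2) * ((Z *\<^sub>v u) \<bullet>c (Z *\<^sub>v u))"
    unfolding cw by (rule scalar_prod_smult_right) simp
  have yw: "Re ((Z *\<^sub>v u) \<bullet>c w) = U"
    unfolding Zw using \<sigma>_pos Zu by (simp add: U_def del: of_real_divide of_real_power)
  have "w \<bullet>c w = complex_of_real (1 / \<sigma>\<^sup>2) * ((Z *\<^sub>v u) \<bullet>c w)"
    by (subst (1) w_def, rule scalar_prod_smult_left) (simp add: w_def)
  then have ww: "Re (w \<bullet>c w) = U / \<sigma>\<^sup>2"
    using yw by (simp del: of_real_divide of_real_power)
  have Pc: "P \<in> carrier_mat k k" and Px: "0 \<le> Re ((P *\<^sub>v x) \<bullet>c x)"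
    using P x by (auto simp: psd_form_def)
  let ?z = "(x @\<^sub>v u) @\<^sub>v w"
  have z: "?z \<in> carrier_vec (k + m + r)" using x u w by simp
  have "Re ((?F *\<^sub>v ?z) \<bullet>c ?z) \<le> 0" using lmi z by (rule psd_form_uminusD)
  then have "2 * Re s * Re ((P *\<^sub>v x) \<bullet>c x) + 2 * U - U - \<gamma>\<^sup>2 * (U / \<sigma>\<^sup>2) \<le> 0"
    using bounded_real_form[OF A B C D Pc x(1) u(1) w x(2), of "\<gamma>\<^sup>2"] yw ww
    unfolding y[symmetric] U_def by simp
  moreover have "0 \<le> 2 * Re s * Re ((P *\<^sub>v x) \<bullet>c x)" using s Px by simp
  ultimately have "U \<le> \<gamma>\<^sup>2 * U / \<sigma>\<^sup>2" by simp
  then have "\<sigma>\<^sup>2 * U \<le> \<gamma>\<^sup>2 * U" using \<sigma>_pos by (simp add: field_simps)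
  then have "\<sigma>\<^sup>2 \<le> \<gamma>\<^sup>2" using u(2) by (simp add: U_def)
  then show ?thesis using \<gamma> by (rule power2_le_imp_le)
qed (use \<gamma> in simp)

section \<open>The error system and the norm bound\<close>

theorem theorem3p4:
  fixes n n' m r p p' L :: nat
    and A B C D :: "mpoly mat"
    and A' B' C' D' :: "mpoly mat"
    and At Bt Ct Dt :: "mpoly mat"
    and q :: "nat \<Rightarrow> mpoly"
    and \<A> :: "(nat \<Rightarrow> real) set"
    and \<gamma> :: real
  assumes "A \<in> poly_mats p n n" "B \<in> poly_mats p n m"
    and "C \<in> poly_mats p r n" "D \<in> poly_mats p r m"
    and "\<And>l. l \<in> {1..L} \<Longrightarrow> q l \<in> polys p"
    and "\<A> = {\<alpha> \<in> topspace (Euclidean_space p). \<forall>l\<in>{1..L}. poly_at \<alpha> (q l) \<ge> 0}"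
    and "compactin (Euclidean_space p) \<A>"
    and "\<exists>w. (\<forall>l\<in>{0..L}. w l \<in> sos_polys p) \<and>
           compactin (Euclidean_space p)
             {\<alpha> \<in> topspace (Euclidean_space p).
                poly_at \<alpha> (w 0) + (\<Sum>l=1..L. poly_at \<alpha> (q l) * poly_at \<alpha> (w l)) \<ge> 0}"
    and "\<gamma> \<ge> 0"
    and "p' \<le> p"
    and "A' \<in> poly_mats p' n' n'" "B' \<in> poly_mats p' n' m"
    and "C' \<in> poly_mats p' r n'" "D' \<in> poly_mats p' r m"
    and "At = four_block_mat A (0\<^sub>m n n') (0\<^sub>m n' n) A'"
    and "Bt = B @\<^sub>r B'"
    and "Ct = append_cols C (- C')"
    and "Dt = D - D'"
    and "\<exists>(\<epsilon>::real) P Q. \<epsilon> > 0 \<and> P \<in> sos_mats p (n + n') \<and>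
           (\<forall>l\<in>{0..L}. Q l \<in> sos_mats p (n + n' + m + r)) \<and>
           bounded_real_mat At Bt Ct Dt P \<gamma>
             + const_poly \<epsilon> \<cdot>\<^sub>m 1\<^sub>m (n + n' + m + r)
             + Q 0 + weighted_sum (n + n' + m + r) L Q q
           = 0\<^sub>m (n + n' + m + r) (n + n' + m + r)"
  shows "\<forall>\<alpha>\<in>\<A>. hinf_norm (tf_minus (transfer_at \<alpha> A B C D)
                                 (transfer_at (reduce_params p' \<alpha>) A' B' C' D')) \<le> ennreal \<gamma>"
proof
  fix \<alpha> assume \<alpha>: "\<alpha> \<in> \<A>"
  let ?N = "n + n' + m + r"
  have A: "A \<in> carrier_mat n n" and B: "B \<in> carrier_mat n m"
    and C: "C \<in> carrier_mat r n" and D: "D \<in> carrier_mat r m"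
    and A': "A' \<in> carrier_mat n' n'" and B': "B' \<in> carrier_mat n' m"
    and C': "C' \<in> carrier_mat r n'" and D': "D' \<in> carrier_mat r m"
    using assms(1-4,11-14) by (auto simp: poly_mats_def)
  have At: "At \<in> carrier_mat (n + n') (n + n')"
    unfolding \<open>At = _\<close> using A A' by (rule four_block_carrier_mat)
  have Bt: "Bt \<in> carrier_mat (n + n') m"
    unfolding \<open>Bt = _\<close> using B B' by (rule carrier_append_rows)
  have Ct: "Ct \<in> carrier_mat r (n + n')" unfolding \<open>Ct = _\<close> using C C' by auto
  have Dt: "Dt \<in> carrier_mat r m" unfolding \<open>Dt = _\<close> using D D' by auto
  obtain \<epsilon> P Q where "\<epsilon> > 0" and P: "P \<in> sos_mats p (n + n')"
    and Q: "\<And>l. l \<in> {0..L} \<Longrightarrow> Q l \<in> sos_mats p ?N"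
    and lmi: "bounded_real_mat At Bt Ct Dt P \<gamma> + const_poly \<epsilon> \<cdot>\<^sub>m 1\<^sub>m ?N + Q 0
      + weighted_sum ?N L Q q = 0\<^sub>m ?N ?N"
    using assms(19) by blast
  have Pc: "P \<in> carrier_mat (n + n') (n + n')" using P by (auto simp: sos_mats_def poly_mats_def)
  have "bounded_real_mat At Bt Ct Dt P \<gamma> \<in> carrier_mat ?N ?N"
    unfolding bounded_real_mat_def using At Bt Ct Pc
    by (intro four_block_carrier_mat) auto
  \<comment> \<open>Membership of \<alpha> in \<open>\<A>\<close> provides the nonnegative values of
    the constraint polynomials.\<close>
  then have "psd_form ?N (- mat_at \<alpha> (bounded_real_mat At Bt Ct Dt P \<gamma>))"
    using lmi \<open>\<epsilon> > 0\<close> Q \<alpha> assms(6) by (intro psd_form_bounded_real_mat[where \<epsilon> = \<epsilon> and p = p]) auto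
  note lmi_at = this[unfolded mat_at_bounded_real_mat[OF At Bt Ct Dt Pc]]
  let ?A = "mat_at \<alpha> A" and ?B = "mat_at \<alpha> B" and ?C = "mat_at \<alpha> C" and ?D = "mat_at \<alpha> D"
  let ?A' = "mat_at \<alpha> A'" and ?B' = "mat_at \<alpha> B'" and ?C' = "mat_at \<alpha> C'" and ?D' = "mat_at \<alpha> D'"
  have At_at: "mat_at \<alpha> At = four_block_mat ?A (0\<^sub>m n n') (0\<^sub>m n' n) ?A'"
    unfolding \<open>At = _\<close> using A A' by (subst mat_at_four_block[of _ n n _ n' _ n']) (auto simp: mat_at_zero)
  have Bt_at: "mat_at \<alpha> Bt = ?B @\<^sub>r ?B'"
    unfolding \<open>Bt = _\<close> using B B' by (rule mat_at_append_rows)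
  have Ct_at: "mat_at \<alpha> Ct = append_cols ?C (- ?C')"
    unfolding \<open>Ct = _\<close> using C C' by (subst mat_at_append_cols[of _ r n _ n']) (auto simp: mat_at_uminus)
  have Dt_at: "mat_at \<alpha> Dt = ?D - ?D'"
    unfolding \<open>Dt = _\<close> using D D' by (rule mat_at_minus)
  note cs = mat_at_carrier[OF A, of \<alpha>] mat_at_carrier[OF B, of \<alpha>] mat_at_carrier[OF C, of \<alpha>] mat_at_carrier[OF D, of \<alpha>]
  note cs' = mat_at_carrier[OF A', of \<alpha>] mat_at_carrier[OF B', of \<alpha>] mat_at_carrier[OF C', of \<alpha>] mat_at_carrier[OF D', of \<alpha>]
  \<comment> \<open>The reduced matrices involve only the first \<open>p'\<close> variables, so both
    systems can be treated at the same point \<alpha>.\<close>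
  have red: "transfer_at (reduce_params p' \<alpha>) A' B' C' D' = transfer ?A' ?B' ?C' ?D'"
    using assms(11-14) by (simp add: transfer_at_def mat_at_reduce_params)
  have "max_singular_value Z \<le> \<gamma>"
    if s: "Re s > 0" and Z: "tf_minus (transfer ?A ?B ?C ?D) (transfer ?A' ?B' ?C' ?D') s = Some Z" for s Z
  proof -
    \<comment> \<open>The difference is defined only where both transfer functions are, so both
      resolvents exist at \<open>s\<close>.\<close>
    obtain X X' where X: "transfer ?A ?B ?C ?D s = Some X"
      and X': "transfer ?A' ?B' ?C' ?D' s = Some X'" and Z_eq: "Z = X - X'"
      using Z by (auto simp: tf_minus_def split: option.splits)
    have Xc: "X \<in> carrier_mat r m" "X' \<in> carrier_mat r m"
      using transfer_carrier[OF cs X] transfer_carrier[OF cs' X'] by auto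
    then have Zc: "Z \<in> carrier_mat r m" by (auto simp: Z_eq)
    \<comment> \<open>The state of the error system stacks the states of the two systems under the
      same input; the zero blocks of \<open>At\<close> keep them decoupled.\<close>
    have state: "\<exists>z\<in>carrier_vec (n + n'). s \<cdot>\<^sub>v z = mat_at \<alpha> At *\<^sub>v z + mat_at \<alpha> Bt *\<^sub>v u \<and>
        Z *\<^sub>v u = mat_at \<alpha> Ct *\<^sub>v z + mat_at \<alpha> Dt *\<^sub>v u" if u: "u \<in> carrier_vec m" for u
    proof -
      obtain x where x: "x \<in> carrier_vec n" "s \<cdot>\<^sub>v x = ?A *\<^sub>v x + ?B *\<^sub>v u" "X *\<^sub>v u = ?C *\<^sub>v x + ?D *\<^sub>v u"
        using transfer_state[OF cs X u] by blast
      obtain x' where x': "x' \<in> carrier_vec n'" "s \<cdot>\<^sub>v x' = ?A' *\<^sub>v x' + ?B' *\<^sub>v u"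
        "X' *\<^sub>v u = ?C' *\<^sub>v x' + ?D' *\<^sub>v u"
        using transfer_state[OF cs' X' u] by blast
      have "s \<cdot>\<^sub>v (x @\<^sub>v x') = (s \<cdot>\<^sub>v x) @\<^sub>v (s \<cdot>\<^sub>v x')" by (rule eq_vecI) auto
      also have "\<dots> = (?A *\<^sub>v x @\<^sub>v ?A' *\<^sub>v x') + (?B *\<^sub>v u @\<^sub>v ?B' *\<^sub>v u)"
        unfolding x(2) x'(2) using cs cs' x(1) x'(1) u
        by (intro append_vec_add[symmetric, of _ n _ _ n']) (auto intro: mult_mat_vec_carrier)
      also have "?A *\<^sub>v x @\<^sub>v ?A' *\<^sub>v x' = mat_at \<alpha> At *\<^sub>v (x @\<^sub>v x')"
        unfolding At_at using cs cs' x(1) x'(1)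
        by (intro mult_mat_vec_split[symmetric]) auto
      also have "?B *\<^sub>v u @\<^sub>v ?B' *\<^sub>v u = mat_at \<alpha> Bt *\<^sub>v u"
        unfolding Bt_at by (rule mat_mult_append[OF cs(2) cs'(2) u, symmetric])
      finally have 1: "s \<cdot>\<^sub>v (x @\<^sub>v x') = mat_at \<alpha> At *\<^sub>v (x @\<^sub>v x') + mat_at \<alpha> Bt *\<^sub>v u" .
      \<comment> \<open>On the output side the signs in \<open>- C'\<close> and
        \<open>D - D'\<close> produce the difference of the two outputs.\<close>
      have "Z *\<^sub>v u = (?C *\<^sub>v x + ?D *\<^sub>v u) - (?C' *\<^sub>v x' + ?D' *\<^sub>v u)"
        unfolding Z_eq x(3)[symmetric] x'(3)[symmetric] using Xc u by (rule minus_mult_distrib_mat_vec)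
      also have "\<dots> = (?C *\<^sub>v x - ?C' *\<^sub>v x') + (?D *\<^sub>v u - ?D' *\<^sub>v u)"
        using carrier_matD[OF C] carrier_matD[OF D] carrier_matD[OF C'] carrier_matD[OF D']
        by (intro eq_vecI) (simp_all del: index_mult_mat_vec)
      also have "?D *\<^sub>v u - ?D' *\<^sub>v u = mat_at \<alpha> Dt *\<^sub>v u"
        unfolding Dt_at using cs(4) cs'(4) u by (rule minus_mult_distrib_mat_vec[symmetric])
      also have "?C *\<^sub>v x - ?C' *\<^sub>v x' = ?C *\<^sub>v x + (- ?C') *\<^sub>v x'"
        using cs(3) cs'(3) x(1) x'(1) by (intro eq_vecI) auto
      also have "\<dots> = mat_at \<alpha> Ct *\<^sub>v (x @\<^sub>v x')"
        unfolding Ct_at using cs(3) cs'(3) x(1) x'(1)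
        by (intro append_cols_mult_vec[symmetric]) auto
      finally show ?thesis using 1 x(1) x'(1) by (intro bexI[of _ "x @\<^sub>v x'"]) auto
    qed
    show ?thesis
      using singular_value_le_of_bounded_real[OF mat_at_carrier[OF At] mat_at_carrier[OF Bt]
          mat_at_carrier[OF Ct] mat_at_carrier[OF Dt] psd_form_sos_mats[OF P] Zc
          less_imp_le[OF s] \<open>\<gamma> \<ge> 0\<close> state lmi_at]
      by (intro max_singular_value_le[OF Zc \<open>\<gamma> \<ge> 0\<close>]) auto
  qed
  \<comment> \<open>The supremum runs over exactly the points treated above: those in the open right
    half plane where the difference is defined.\<close>
  then show "hinf_norm (tf_minus (transfer_at \<alpha> A B C D)
      (transfer_at (reduce_params p' \<alpha>) A' B' C' D')) \<le> ennreal \<gamma>"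
    unfolding hinf_norm_def red transfer_at_def[of \<alpha>]
    by (intro SUP_least ennreal_leI) (auto simp: dom_def)
qed

end
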